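(* Let $\mathcal{L}, H:\mathbb{R}^d\to\mathbb{R}$ be differentiable, let $\beta$ be a constant coefficient, and let $\theta_t$ be a solution of the continuous-time flow $$\frac{d\theta}{dt} = -\nabla\mathcal{L}(\theta) - \beta\nabla H(\theta).$$ Then along this flow $$\frac{d}{dt}H(\theta_t) = I_\theta(t) - D_\theta(t),$$ where $I_\theta(t) = -\nabla H(\theta_t)^\top\nabla\mathcal{L}(\theta_t)$ is the injection term and $D_\theta(t) = \beta\|\nabla H(\theta_t)\|^2$ is the dissipation term; that is, $$\frac{d}{dt}H(\theta_t) = -\nabla H(\theta_t)^\top\nabla\mathcal{L}(\theta_t) - \beta\|\nabla H(\theta_t)\|^2.$$
   Context: $\mathcal{L}$ is a loss function and $H$ a differentiable entropy surrogate, both viewed as real-valued functions of the parameter $\theta\in\mathbb{R}^d$; $\|\cdot\|$ is the Euclidean norm. *)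

theory Defs
  imports "HOL-Analysis.Analysis"
begin

definition gradient :: "(real^'n \<Rightarrow> real) \<Rightarrow> real^'n \<Rightarrow> real^'n" where
  "gradient f x = (THE g. GDERIV f x :> g)"

definition is_solution_on ::
  "(real^'n \<Rightarrow> real^'n) \<Rightarrow> real set \<Rightarrow> (real \<Rightarrow> real^'n) \<Rightarrow> bool" where
  \<comment> \<open>The derivative is taken within \<open>T\<close>, so it is one-sided at an endpoint belonging to \<open>T\<close>.\<close>
  "is_solution_on F T \<theta> \<longleftrightarrow>
     (\<forall>t\<in>T. (\<theta> has_vector_derivative F (\<theta> t)) (at t within T))"

definition injection_term ::
  "(real^'n \<Rightarrow> real) \<Rightarrow> (real^'n \<Rightarrow> real) \<Rightarrow> (real \<Rightarrow> real^'n) \<Rightarrow> real \<Rightarrow> real" where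
  "injection_term L H \<theta> t = - (gradient H (\<theta> t) \<bullet> gradient L (\<theta> t))"

definition dissipation_term ::
  "real \<Rightarrow> (real^'n \<Rightarrow> real) \<Rightarrow> (real \<Rightarrow> real^'n) \<Rightarrow> real \<Rightarrow> real" where
  "dissipation_term \<beta> H \<theta> t = \<beta> * (norm (gradient H (\<theta> t)))\<^sup>2"

end

theory Submission
  imports Defs
begin

text \<open>The identity is the chain rule followed by bilinearity of the inner product: along the
  flow, \<open>H\<close> changes at the rate of its gradient paired with the velocity. The
  \<open>L\<close> part of the velocity contributes the injection term, and the
  \<open>\<beta>\<close> part pairs the gradient of \<open>H\<close> with itself, which gives the
  dissipation term. \<open>has_real_derivative_along_curve\<close> is the chain rule; since
  \<open>gradient\<close> is a definite description, \<open>GDERIV_gradient\<close> must first show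
  that it denotes the actual gradient.\<close>

lemma linear_functional_eq_inner:
  fixes f :: "'a::euclidean_space \<Rightarrow> real"
  assumes "linear f"
  shows "f h = h \<bullet> adjoint f 1"
  using adjoint_works[OF assms, of h 1] by simp

lemma GDERIV_unique:
  fixes f :: "'a::euclidean_space \<Rightarrow> real"
  assumes "GDERIV f x :> g" and "GDERIV f x :> g'"
  shows "g = g'"
proof -
  have "(\<lambda>h. h \<bullet> g) = (\<lambda>h. h \<bullet> g')"
    using assms unfolding gderiv_def by (rule has_derivative_unique)
  then show ?thesis
    by (metis vector_eq_ldot)
qed

text \<open>Existence is the Riesz representation of the Frechet derivative; together with
  \<open>GDERIV_unique\<close> it makes the \<open>THE\<close> in \<open>gradient\<close> well
  defined.\<close>

lemma GDERIV_gradient: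
  fixes f :: "real^'n \<Rightarrow> real"
  assumes "f differentiable (at x)"
  shows "GDERIV f x :> gradient f x"
proof -
  obtain f' where f': "(f has_derivative f') (at x)"
    using assms unfolding differentiable_def by blast
  \<comment> \<open>The Riesz vector of a functional is its adjoint applied to the scalar 1.\<close>
  have "f' = (\<lambda>h. h \<bullet> adjoint f' 1)"
    using linear_functional_eq_inner[OF has_derivative_linear[OF f']] by blast
  with f' have "GDERIV f x :> adjoint f' 1"
    unfolding gderiv_def by simp
  then show ?thesis
    unfolding gradient_def by (rule theI) (rule GDERIV_unique[OF _ \<open>GDERIV f x :> adjoint f' 1\<close>])
qed

text \<open>Only the curve is differentiated within \<open>T\<close>; \<open>f\<close> has a full
  derivative at \<open>\<theta> t\<close>, so the chain rule also covers one-sided derivatives at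
  endpoints of \<open>T\<close>.\<close>

lemma has_real_derivative_along_curve:
  fixes f :: "real^'n \<Rightarrow> real"
  assumes f: "f differentiable (at (\<theta> t))"
    and \<theta>: "(\<theta> has_vector_derivative v) (at t within T)"
  shows "((\<lambda>s. f (\<theta> s)) has_real_derivative gradient f (\<theta> t) \<bullet> v) (at t within T)"
proof -
  have "((\<lambda>s. f (\<theta> s)) has_derivative (\<lambda>h. (h *\<^sub>R v) \<bullet> gradient f (\<theta> t))) (at t within T)"
    using has_derivative_compose[OF \<theta>[unfolded has_vector_derivative_def]
        GDERIV_gradient[OF f, unfolded gderiv_def]] .
  then show ?thesis
    unfolding has_field_derivative_def
    by (rule has_derivative_eq_rhs) (simp add: fun_eq_iff inner_commute mult.commute)
qed

theorem theorem2:
  fixes L H :: "real^'n \<Rightarrow> real"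
    and \<beta> :: real
    and \<theta> :: "real \<Rightarrow> real^'n"
    and T :: "real set"
  assumes "\<And>x. L differentiable (at x)"
    and "\<And>x. H differentiable (at x)"
    and "is_interval T"
    and "is_solution_on (\<lambda>x. - gradient L x - \<beta> *\<^sub>R gradient H x) T \<theta>"
  shows "\<forall>t\<in>T.
      ((\<lambda>s. H (\<theta> s)) has_real_derivative
         injection_term L H \<theta> t - dissipation_term \<beta> H \<theta> t) (at t within T) \<and>
      ((\<lambda>s. H (\<theta> s)) has_real_derivative
         - (gradient H (\<theta> t) \<bullet> gradient L (\<theta> t))
         - \<beta> * (norm (gradient H (\<theta> t)))\<^sup>2) (at t within T)"
proof
  fix t assume "t \<in> T"
  let ?gL = "gradient L (\<theta> t)" and ?gH = "gradient H (\<theta> t)"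
  have "(\<theta> has_vector_derivative - ?gL - \<beta> *\<^sub>R ?gH) (at t within T)"
    using assms(4) \<open>t \<in> T\<close> unfolding is_solution_on_def by blast
  then have "((\<lambda>s. H (\<theta> s)) has_real_derivative ?gH \<bullet> (- ?gL - \<beta> *\<^sub>R ?gH)) (at t within T)"
    by (rule has_real_derivative_along_curve[OF assms(2)])
  \<comment> \<open>The pairing of \<open>?gH\<close> with itself is its squared norm.\<close>
  moreover have "?gH \<bullet> (- ?gL - \<beta> *\<^sub>R ?gH) = - (?gH \<bullet> ?gL) - \<beta> * (norm ?gH)\<^sup>2"
    by (simp add: inner_diff_right power2_norm_eq_inner)
  ultimately show "((\<lambda>s. H (\<theta> s)) has_real_derivative
         injection_term L H \<theta> t - dissipation_term \<beta> H \<theta> t) (at t within T) \<and>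
      ((\<lambda>s. H (\<theta> s)) has_real_derivative
         - (?gH \<bullet> ?gL) - \<beta> * (norm ?gH)\<^sup>2) (at t within T)"
    unfolding injection_term_def dissipation_term_def by simp
qed

end
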